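(* Let $d\in\mathbb{N}^+$ and let $\psi$ be a gauge function with $\lim_{r\to0+}\psi(r)/r^{d+1}=\infty$. Then for the prevalent $f\in C([0,1],\mathbb{R}^d)$ we have $$\mathcal{H}^{\psi}(\operatorname{graph}(f))>0.$$
   Context: Prevalence: for an abelian Polish group $G$, a set $A\subset G$ is shy if there exist a Borel set $B\supset A$ in $G$ and a Borel probability measure $\nu$ on $G$ with $\nu(B+x)=0$ for all $x\in G$; complements of shy sets are prevalent. "For the prevalent $f\in G$ property $P$ holds" means that $\{f\in G: P(f)\}$ is prevalent. $C([0,1],\mathbb{R}^d)$ is the Banach space of continuous maps $[0,1]\to\mathbb{R}^d$ with the maximum norm (an abelian Polish group under addition). A gauge function is a non-decreasing function $\varphi:[0,\infty)\to[0,\infty)$ with $\varphi(0)=0$. The $\varphi$-Hausdorff measure of a metric space $X$ is $\mathcal{H}^\varphi(X)=\lim_{\delta\to0+}\mathcal{H}^\varphi_\delta(X)$, where $\mathcal{H}^\varphi_\delta(X)=\inf\{\sum_{i=1}^\infty\varphi(\operatorname{diam}A_i): X\subset\bigcup_{i=1}^\infty A_i,\ \operatorname{diam}A_i\leq\delta\text{ for all }i\}$, with $\operatorname{diam}\emptyset=0$. $\operatorname{graph}(f)=\{(x,f(x)): x\in[0,1]\}\subset[0,1]\times\mathbb{R}^d$ with the Euclidean metric. *)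

theory Defs
  imports "HOL-Analysis.Analysis" "HOL-Probability.Probability_Measure"
begin

section \<open>Shy and prevalent sets in abelian Polish groups\<close>

definition shy :: "'a::{topological_ab_group_add, polish_space} set \<Rightarrow> bool" where
  "shy A \<longleftrightarrow> (\<exists>B \<in> sets borel. A \<subseteq> B \<and>
     (\<exists>\<nu> :: 'a measure. prob_space \<nu> \<and> sets \<nu> = sets borel \<and>
        (\<forall>x. emeasure \<nu> ((\<lambda>b. b + x) ` B) = 0)))"

definition prevalent :: "'a::{topological_ab_group_add, polish_space} set \<Rightarrow> bool" where
  "prevalent A \<longleftrightarrow> shy (- A)"

text \<open>\<^const>\<open>emeasure\<close> is \<open>0\<close> on non-measurable sets; the translates above
  are always Borel, so this convention never comes into play.\<close>

lemma borel_translate: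
  fixes B :: "'a::topological_ab_group_add set"
  assumes "B \<in> sets borel"
  shows "(\<lambda>b. b + x) ` B \<in> sets borel"
proof -
  have eq: "(\<lambda>b. b + x) ` B = (\<lambda>b. b + (- x)) -` B \<inter> space borel"
  proof (intro set_eqI iffI)
    fix y assume "y \<in> (\<lambda>b. b + (- x)) -` B \<inter> space borel"
    then have "y + (- x) \<in> B" "y = (y + (- x)) + x" by (auto simp: add.assoc)
    then show "y \<in> (\<lambda>b. b + x) ` B" by blast
  qed (auto simp: add.assoc)
  have "continuous_on UNIV (\<lambda>b::'a. b + (- x))"
    by (intro continuous_intros)
  then show ?thesis
    unfolding eq by (intro measurable_sets[OF borel_measurable_continuous_onI] assms)
qed


section \<open>The Polish space of continuous functions on a compact metric space\<close>

class compact_metric_space = metric_space + second_countable_topology +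
  assumes compact_UNIV_metric: "compact (UNIV :: 'a set)"

lemma continuous_imp_bcontfun:
  fixes f :: "'a::compact_metric_space \<Rightarrow> 'b::metric_space"
  assumes "continuous_on UNIV f"
  shows "f \<in> bcontfun"
  using assms compact_continuous_image[OF assms compact_UNIV_metric]
  by (auto simp: bcontfun_def compact_imp_bounded)

lemma bcontfun_countable_dense:
  "\<exists>D :: ('a::compact_metric_space \<Rightarrow>\<^sub>C 'b::polish_space) set.
     countable D \<and> (\<forall>f e. 0 < e \<longrightarrow> (\<exists>g\<in>D. dist f g < e))"
proof -
  obtain BX :: "'a set set" where BX: "countable BX" "topological_basis BX"
    using ex_countable_basis by blast
  obtain BY :: "'b set set" where BY: "countable BY" "topological_basis BY"
    using ex_countable_basis by blast
  define P where "P = {S. finite S \<and> S \<subseteq> BX \<times> BY}"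
  have "countable P"
    unfolding P_def using BX BY by (intro countable_Collect_finite_subset) auto
  define Q :: "('a set \<times> 'b set) set \<Rightarrow> ('a \<Rightarrow>\<^sub>C 'b) \<Rightarrow> bool"
    where "Q = (\<lambda>S f. \<forall>(V, U)\<in>S. apply_bcontfun f ` V \<subseteq> U)"
  define D where "D = (\<lambda>S. SOME f. Q S f) ` P"
  have "\<exists>g\<in>D. dist f g < e" if "0 < e" for f :: "'a \<Rightarrow>\<^sub>C 'b" and e
  proof -
    have "\<exists>V U. V \<in> BX \<and> U \<in> BY \<and> x \<in> V \<and> f ` V \<subseteq> U \<and> U \<subseteq> ball (f x) (e/4)" for x
    proof -
      have "f x \<in> ball (f x) (e/4)" using \<open>0 < e\<close> by simp
      then obtain U where U: "U \<in> BY" "f x \<in> U" "U \<subseteq> ball (f x) (e/4)"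
        using topological_basisE[OF BY(2) open_ball] by metis
      have "open U" using BY(2) U(1) by (rule topological_basis_open)
      then have "open (apply_bcontfun f -` U)"
        by (intro open_vimage) auto
      moreover have "x \<in> apply_bcontfun f -` U" using U by simp
      ultimately obtain V where V: "V \<in> BX" "x \<in> V" "V \<subseteq> apply_bcontfun f -` U"
        using topological_basisE[OF BX(2)] by metis
      with U show ?thesis by blast
    qed
    then obtain V U where VU: "\<And>x. V x \<in> BX" "\<And>x. U x \<in> BY" "\<And>x. x \<in> V x"
      "\<And>x. f ` V x \<subseteq> U x" "\<And>x. U x \<subseteq> ball (f x) (e/4)"
      by metis
    have "open (V x)" for x using BX(2) VU(1) by (rule topological_basis_open)
    moreover have "UNIV \<subseteq> (\<Union>x. V x)" using VU(3) by blast
    ultimately obtain C where C: "finite C" "UNIV \<subseteq> (\<Union>x\<in>C. V x)"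
      using compactE_image[OF compact_UNIV_metric, of UNIV V] by metis
    define S where "S = (\<lambda>x. (V x, U x)) ` C"
    have "S \<in> P" using C VU by (auto simp: P_def S_def)
    have "Q S f" using VU(4) by (auto simp: Q_def S_def)
    then have QS: "Q S (SOME f. Q S f)" by (rule someI)
    define g where "g = (SOME f. Q S f)"
    have "dist (f y) (g y) \<le> e/2" for y
    proof -
      obtain x where x: "x \<in> C" "y \<in> V x" using C by blast
      have "f y \<in> U x" using VU(4) x by blast
      moreover have "g y \<in> U x" using QS x by (auto simp: Q_def S_def g_def)
      ultimately have "dist (f x) (f y) < e/4" "dist (f x) (g y) < e/4"
        using VU(5)[of x] by (auto simp: subset_iff)
      then show ?thesis
        using dist_triangle3[of "f y" "g y" "f x"] by simp
    qed
    then have "dist f g \<le> e/2" by (rule dist_bound)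
    moreover have "g \<in> D" using \<open>S \<in> P\<close> by (auto simp: D_def g_def)
    ultimately show ?thesis using \<open>0 < e\<close> by (intro bexI[of _ g]) auto
  qed
  moreover have "countable D" unfolding D_def using \<open>countable P\<close> by simp
  ultimately show ?thesis by blast
qed

instance bcontfun :: (compact_metric_space, polish_space) second_countable_topology
proof
  obtain D :: "('a \<Rightarrow>\<^sub>C 'b) set" where D: "countable D" "\<And>f e. 0 < e \<Longrightarrow> \<exists>g\<in>D. dist f g < e"
    using bcontfun_countable_dense by metis
  define B where "B = (\<lambda>(g, n). ball g (1 / Suc n)) ` (D \<times> (UNIV :: nat set))"
  have "countable B" unfolding B_def using D(1) by (intro countable_image) auto
  moreover have "topological_basis B"
  proof (rule topological_basisI)
    fix W :: "('a \<Rightarrow>\<^sub>C 'b) set" and f assume "open W" "f \<in> W"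
    then obtain e where e: "0 < e" "ball f e \<subseteq> W" by (meson open_contains_ball)
    obtain n where n: "1 / Suc n < e / 2"
      using e(1) nat_approx_posE[of "e/2"] by auto
    obtain g where g: "g \<in> D" "dist f g < 1 / Suc n" using D(2)[of "1 / Suc n" f] by auto
    have "ball g (1 / Suc n) \<subseteq> W"
    proof
      fix h assume "h \<in> ball g (1 / Suc n)"
      then have "dist f h < e"
        using dist_triangle[of f h g] g(2) n by simp
      then show "h \<in> W" using e(2) by auto
    qed
    moreover have "ball g (1 / Suc n) \<in> B"
      using g(1) unfolding B_def by (intro image_eqI[where x = "(g, n)"]) auto
    moreover have "f \<in> ball g (1 / Suc n)" using g(2) by (simp add: dist_commute)
    ultimately show "\<exists>B'\<in>B. f \<in> B' \<and> B' \<subseteq> W" by blast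
  qed (auto simp: B_def)
  ultimately show "\<exists>B :: ('a \<Rightarrow>\<^sub>C 'b) set set. countable B \<and> open = generate_topology B"
    using topological_basis_imp_subbasis by blast
qed

instance bcontfun :: (compact_metric_space, polish_space) polish_space ..


section \<open>The unit interval as a type\<close>

text \<open>By compactness, \<open>unit_interval \<Rightarrow>\<^sub>C (real^'d)\<close> consists of all
  continuous maps from \<open>[0,1]\<close> to \<open>real^'d\<close> (cf. \<open>continuous_imp_bcontfun\<close>),
  with the maximum norm.\<close>

typedef unit_interval = "{0..1::real}"
  morphisms real_of_unit unit_of_real
  by (rule exI[of _ 0]) simp

instantiation unit_interval :: metric_space
begin

definition dist_unit_interval :: "unit_interval \<Rightarrow> unit_interval \<Rightarrow> real" where
  "dist_unit_interval x y = dist (real_of_unit x) (real_of_unit y)"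

definition uniformity_unit_interval :: "(unit_interval \<times> unit_interval) filter" where
  "uniformity_unit_interval = (INF e\<in>{0<..}. principal {(x, y). dist x y < e})"

definition open_unit_interval :: "unit_interval set \<Rightarrow> bool" where
  "open_unit_interval U \<longleftrightarrow> (\<forall>x\<in>U. \<forall>\<^sub>F (x', y) in uniformity. x' = x \<longrightarrow> y \<in> U)"

instance
proof
  show "dist x y = 0 \<longleftrightarrow> x = y" for x y :: unit_interval
    by (simp add: dist_unit_interval_def real_of_unit_inject)
  show "dist x y \<le> dist x z + dist y z" for x y z :: unit_interval
    unfolding dist_unit_interval_def by (rule dist_triangle2)
qed (rule open_unit_interval_def uniformity_unit_interval_def)+

end

lemma continuous_on_real_of_unit: "continuous_on S real_of_unit"
  unfolding continuous_on_iff dist_unit_interval_def by auto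

lemma continuous_on_unit_of_real: "continuous_on {0..1} unit_of_real"
  unfolding continuous_on_iff dist_unit_interval_def
  by (auto simp: unit_of_real_inverse)

lemma unit_of_real_image: "unit_of_real ` {0..1} = UNIV"
  by (metis type_definition.Abs_image type_definition_unit_interval)

instance unit_interval :: compact_metric_space
proof
  show "compact (UNIV :: unit_interval set)"
    using compact_continuous_image[OF continuous_on_unit_of_real] by (simp add: unit_of_real_image)
  obtain B :: "real set set" where B: "countable B" "topological_basis B"
    using ex_countable_basis by blast
  have "topological_basis ((\<lambda>U. real_of_unit -` U) ` B)"
  proof (rule topological_basisI)
    fix W :: "unit_interval set" and x assume "open W" "x \<in> W"
    then obtain e where e: "0 < e" "ball x e \<subseteq> W" by (meson open_contains_ball)
    obtain U where U: "U \<in> B" "real_of_unit x \<in> U" "U \<subseteq> ball (real_of_unit x) e"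
      using topological_basisE[OF B(2) open_ball, of "real_of_unit x" "real_of_unit x" e] e(1)
      by (metis centre_in_ball)
    then have "real_of_unit -` U \<subseteq> ball x e" by (auto simp: dist_unit_interval_def)
    then show "\<exists>B'\<in>(\<lambda>U. real_of_unit -` U) ` B. x \<in> B' \<and> B' \<subseteq> W"
      using U e(2) by blast
  next
    fix V assume "V \<in> (\<lambda>U. real_of_unit -` U) ` B"
    then show "open V"
      using topological_basis_open[OF B(2)] continuous_on_real_of_unit[of UNIV]
      by (auto intro: open_vimage)
  qed
  then show "\<exists>B :: unit_interval set set. countable B \<and> open = generate_topology B"
    using B(1) topological_basis_imp_subbasis by blast
qed


section \<open>Generalized Hausdorff measures\<close>

text \<open>A gauge function on \<open>[0,\<infinity>)\<close> is represented by a function on the reals of which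
  only the values on \<open>{0..}\<close> matter; monotonicity and the value at \<open>0\<close> make these nonnegative.\<close>

definition gauge_function :: "(real \<Rightarrow> real) \<Rightarrow> bool" where
  "gauge_function \<phi> \<longleftrightarrow> mono_on {0..} \<phi> \<and> \<phi> 0 = 0"

text \<open>The covering sets range over subsets of the ambient space; replacing them by their
  intersections with \<open>X\<close> shows that, for gauge functions, this gives the measure of \<open>X\<close> as a metric space in its
  own right.  Boundedness is explicit because \<^const>\<open>diameter\<close> has an unspecified value
  on unbounded sets.\<close>

definition hausdorff_pre :: "(real \<Rightarrow> real) \<Rightarrow> real \<Rightarrow> 'a::metric_space set \<Rightarrow> ennreal" where
  "hausdorff_pre \<phi> \<delta> X =
     (INF A \<in> {A :: nat \<Rightarrow> 'a set. X \<subseteq> (\<Union>i. A i) \<and> (\<forall>i. bounded (A i) \<and> diameter (A i) \<le> \<delta>)}.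
        \<Sum>i. ennreal (\<phi> (diameter (A i))))"

definition hausdorff_measure :: "(real \<Rightarrow> real) \<Rightarrow> 'a::metric_space set \<Rightarrow> ennreal" where
  "hausdorff_measure \<phi> X = Lim (at_right 0) (\<lambda>\<delta>. hausdorff_pre \<phi> \<delta> X)"

lemma hausdorff_pre_antimono: "\<delta> \<le> \<delta>' \<Longrightarrow> hausdorff_pre \<phi> \<delta>' X \<le> hausdorff_pre \<phi> \<delta> X"
  unfolding hausdorff_pre_def by (rule INF_superset_mono) (auto intro: order_trans)

lemma hausdorff_pre_tendsto_SUP:
  "((\<lambda>\<delta>. hausdorff_pre \<phi> \<delta> X) \<longlongrightarrow> (SUP \<delta>\<in>{0<..}. hausdorff_pre \<phi> \<delta> X)) (at_right 0)"
proof (rule increasing_tendsto)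
  show "\<forall>\<^sub>F \<delta> in at_right 0. hausdorff_pre \<phi> \<delta> X \<le> (SUP \<delta>\<in>{0<..}. hausdorff_pre \<phi> \<delta> X)"
    by (auto simp: eventually_at_right_field intro!: exI[of _ 1] SUP_upper)
next
  fix c assume "c < (SUP \<delta>\<in>{0<..}. hausdorff_pre \<phi> \<delta> X)"
  then obtain d where d: "0 < d" "c < hausdorff_pre \<phi> d X"
    by (auto simp: less_SUP_iff)
  then have "c < hausdorff_pre \<phi> \<delta> X" if "0 < \<delta>" "\<delta> < d" for \<delta>
    using hausdorff_pre_antimono[of \<delta> d \<phi> X] that by (meson less_le_trans less_imp_le)
  then show "\<forall>\<^sub>F \<delta> in at_right 0. c < hausdorff_pre \<phi> \<delta> X"
    using d(1) by (auto simp: eventually_at_right_field)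
qed

lemma hausdorff_measure_eq_SUP:
  "hausdorff_measure \<phi> X = (SUP \<delta>\<in>{0<..}. hausdorff_pre \<phi> \<delta> X)"
  unfolding hausdorff_measure_def
  by (rule tendsto_Lim[OF _ hausdorff_pre_tendsto_SUP]) simp


section \<open>Graphs\<close>

text \<open>The metric on the product type is the Euclidean one,
  \<open>dist (x, y) (x', y') = sqrt ((dist x x')\<^sup>2 + (dist y y')\<^sup>2)\<close>.\<close>

definition graph_of :: "(unit_interval \<Rightarrow>\<^sub>C 'b::metric_space) \<Rightarrow> (real \<times> 'b) set" where
  "graph_of f = {(real_of_unit x, apply_bcontfun f x) | x. True}"

end

theory Submission
  imports Defs "HOL-Probability.Infinite_Product_Measure"
begin

text \<open>Let \<open>\<lambda>\<close> be Lebesgue measure on \<open>[0,1]\<close>. The transverse measure is the law of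
  \<open>f = \<Sum>n. 2\<^sup>-\<^sup>n f\<^sub>n\<close>, where \<open>f\<^sub>n\<close> interpolates independent uniform points of the unit cube at the
  nodes \<open>j / N\<^sub>n\<close>. For every fixed \<open>g\<close>, the increment of \<open>f + g\<close> between points at distance more than
  \<open>2 / N\<^sub>n\<close> has a density bounded in terms of \<open>n\<close> only. Hence, if \<open>N\<^sub>n\<close> is large enough, the expected
  \<open>\<lambda> \<times> \<lambda>\<close>-measure of the pairs \<open>(x, y)\<close> for which the points of the graph over \<open>x\<close> and \<open>y\<close> are
  \<open>s\<close>-close is at most \<open>c\<^sub>n s\<^sup>d\<^sup>+\<^sup>1\<close>, where \<open>c\<^sub>n\<close> does not depend on the scale \<open>s = s\<^sub>n\<^sub>+\<^sub>1\<close>.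

  The scales \<open>s\<^sub>n\<close> can therefore be chosen such that \<open>\<psi>(r) \<ge> 8\<^sup>n c\<^sub>n r\<^sup>d\<^sup>+\<^sup>1\<close> for \<open>r \<le> s\<^sub>n\<close>.
  If the graph is covered, the covering sets with diameter in \<open>(s\<^sub>n\<^sub>+\<^sub>1, s\<^sub>n]\<close> meet few cells of the
  grid of side \<open>s\<^sub>n\<^sub>+\<^sub>1\<close>, and by Cauchy--Schwarz these cells carry \<open>\<lambda>\<close>-mass \<open>O(2\<^sup>-\<^sup>n S\<^sup>1\<^sup>/\<^sup>2)\<close>, where \<open>S\<close>
  is the sum of the gauges. Summing over \<open>n\<close> bounds \<open>S\<close> from below.\<close>

section \<open>Near pairs of graph points\<close>

definition unit_lebesgue :: "unit_interval measure" where
  "unit_lebesgue = distr (restrict_space lborel {0..1}) borel unit_of_real"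

lemma sets_unit_lebesgue [simp, measurable_cong]: "sets unit_lebesgue = sets borel"
  and space_unit_lebesgue [simp]: "space unit_lebesgue = UNIV"
  by (simp_all add: unit_lebesgue_def)

lemma measurable_unit_of_real: "unit_of_real \<in> restrict_space lborel {0..1} \<rightarrow>\<^sub>M borel"
proof -
  have "unit_of_real \<in> restrict_space borel {0..1} \<rightarrow>\<^sub>M borel"
    by (rule borel_measurable_continuous_on_restrict[OF continuous_on_unit_of_real])
  then show ?thesis
    by (simp cong: measurable_cong_sets sets_restrict_space_cong)
qed

lemma emeasure_unit_lebesgue:
  assumes "A \<in> sets borel"
  shows "emeasure unit_lebesgue A = emeasure lborel (unit_of_real -` A \<inter> {0..1})"
  using assms measurable_unit_of_real unfolding unit_lebesgue_def
  by (subst emeasure_distr) (auto simp: space_restrict_space intro!: emeasure_restrict_space)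

lemma prob_space_unit_lebesgue: "prob_space unit_lebesgue"
  by standard (simp add: emeasure_unit_lebesgue)

interpretation unit_lebesgue: prob_space unit_lebesgue
  by (rule prob_space_unit_lebesgue)

interpretation unit_lebesgue_pair: pair_prob_space unit_lebesgue unit_lebesgue ..

lemma emeasure_unit_lebesgue_ball_le:
  assumes "0 \<le> r"
  shows "emeasure unit_lebesgue {y. dist x y \<le> r} \<le> ennreal (2 * r)"
proof -
  have "{y. dist x y \<le> r} = cball x r" by auto
  then have "{y. dist x y \<le> r} \<in> sets borel" by simp
  then have "emeasure unit_lebesgue {y. dist x y \<le> r}
      = emeasure lborel (unit_of_real -` {y. dist x y \<le> r} \<inter> {0..1})"
    by (rule emeasure_unit_lebesgue)
  also have "\<dots> \<le> emeasure lborel {real_of_unit x - r .. real_of_unit x + r}"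
    by (intro emeasure_mono) (auto simp: dist_unit_interval_def dist_real_def unit_of_real_inverse abs_le_iff algebra_simps)
  also have "\<dots> = ennreal (2 * r)" using assms by simp
  finally show ?thesis .
qed

lemma sets_unit_lebesgue_pair: "sets (unit_lebesgue \<Otimes>\<^sub>M unit_lebesgue) = sets borel"
  by (simp add: borel_prod[symmetric] cong: sets_pair_measure_cong)

lemma strip_sets: "{(x, y). dist x y \<le> r} \<in> sets (unit_lebesgue \<Otimes>\<^sub>M unit_lebesgue)"
proof -
  have "closed {p :: unit_interval \<times> unit_interval. dist (fst p) (snd p) \<le> r}"
    by (intro closed_Collect_le continuous_intros)
  then show ?thesis
    unfolding sets_unit_lebesgue_pair by (simp add: split_beta')
qed

text \<open>Every slice of the strip is a ball, so Fubini applies. The bound serves twice: for pairs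
  too close to be separated by the nodes, and for the one factor of the scale that comes from the
  time coordinate.\<close>

lemma emeasure_unit_lebesgue_strip_le:
  assumes "0 \<le> r"
  shows "emeasure (unit_lebesgue \<Otimes>\<^sub>M unit_lebesgue) {(x, y). dist x y \<le> r} \<le> ennreal (2 * r)"
proof -
  have "emeasure (unit_lebesgue \<Otimes>\<^sub>M unit_lebesgue) {(x, y). dist x y \<le> r}
     = (\<integral>\<^sup>+x. emeasure unit_lebesgue {y. dist x y \<le> r} \<partial>unit_lebesgue)"
    by (subst unit_lebesgue.emeasure_pair_measure_alt[OF strip_sets]) (auto simp: vimage_def)
  also have "\<dots> \<le> (\<integral>\<^sup>+x. ennreal (2 * r) \<partial>unit_lebesgue)"
    by (intro nn_integral_mono emeasure_unit_lebesgue_ball_le assms)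
  also have "\<dots> = ennreal (2 * r)"
    using unit_lebesgue.emeasure_space_1 by simp
  finally show ?thesis .
qed

text \<open>Points are balls of radius 0. This disposes of covering sets of diameter 0, to which no
  growth condition on the gauge applies.\<close>

lemma countable_null_unit_lebesgue:
  assumes "countable A"
  shows "emeasure unit_lebesgue A = 0"
proof -
  have "emeasure unit_lebesgue {x} = 0" for x
  proof -
    have "{y. dist x y \<le> 0} = {x}" by auto
    then show ?thesis using emeasure_unit_lebesgue_ball_le[of 0 x] by simp
  qed
  then have "(\<Union>x\<in>A. {x}) \<in> null_sets unit_lebesgue"
    using assms by (intro null_sets_UN') (auto simp: null_sets_def)
  then show ?thesis by auto
qed

section \<open>Joint continuity of evaluation and measurability of near pairs\<close>

lemma tendsto_apply_bcontfun:
  fixes f :: "'c \<Rightarrow> 'a::t2_space \<Rightarrow>\<^sub>C 'b::metric_space"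
  assumes "(f \<longlongrightarrow> f0) F" "(g \<longlongrightarrow> x0) F"
  shows "((\<lambda>c. f c (g c)) \<longlongrightarrow> f0 x0) F"
proof -
  have "isCont (apply_bcontfun f0) x0"
    using continuous_on_apply_bcontfun[of UNIV f0] unfolding continuous_on_eq_continuous_at[OF open_UNIV] by blast
  then have 1: "((\<lambda>c. f0 (g c)) \<longlongrightarrow> f0 x0) F"
    using assms(2) by (rule isCont_tendsto_compose)
  \<comment> \<open>The uniform distance controls the change of function, continuity of
    \<open>f0\<close> the change of argument.\<close>
  have "((\<lambda>c. dist (f c) f0 + dist (f0 (g c)) (f0 x0)) \<longlongrightarrow> 0 + 0) F"
    by (intro tendsto_add iffD1[OF tendsto_dist_iff] assms(1) 1)
  moreover have "dist (f c (g c)) (f0 x0) \<le> dist (f c) f0 + dist (f0 (g c)) (f0 x0)" for c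
    using dist_bounded[of "f c" "g c" f0] dist_triangle[of "f c (g c)" "f0 x0" "f0 (g c)"] by linarith
  ultimately show ?thesis
    by (elim metric_tendsto_imp_tendsto) simp
qed

lemma continuous_on_eval_bcontfun [continuous_intros]:
  fixes f :: "'c::topological_space \<Rightarrow> 'a::t2_space \<Rightarrow>\<^sub>C 'b::metric_space"
  assumes "continuous_on S f" "continuous_on S g"
  shows "continuous_on S (\<lambda>c. f c (g c))"
  using assms by (auto simp: continuous_on_def intro: tendsto_apply_bcontfun)

text \<open>Closeness is measured coordinatewise: this fits both the cubic grid cells of the
  covering argument and the boxes in which a uniform coefficient must fall.\<close>

definition near_pairs :: "real \<Rightarrow> (unit_interval \<Rightarrow>\<^sub>C (real^'d)) \<Rightarrow> (unit_interval \<times> unit_interval) set" where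
  "near_pairs s f = {(x, y). dist x y \<le> s \<and> (\<forall>i. \<bar>f x $ i - f y $ i\<bar> \<le> s)}"

text \<open>The set is closed by joint continuity of evaluation, and second countability makes the
  product sigma-algebra the Borel one. Measurability jointly with \<open>f\<close> is what Fubini
  over the random function requires.\<close>

lemma near_pairs_measurable:
  "{(f :: unit_interval \<Rightarrow>\<^sub>C (real^'d), z). z \<in> near_pairs s f} \<in> sets (borel \<Otimes>\<^sub>M (unit_lebesgue \<Otimes>\<^sub>M unit_lebesgue))"
proof -
  have cl: "closed {p :: (unit_interval \<Rightarrow>\<^sub>C (real^'d)) \<times> unit_interval \<times> unit_interval.
      dist (fst (snd p)) (snd (snd p)) \<le> s \<and>
      (\<forall>i. \<bar>apply_bcontfun (fst p) (fst (snd p)) $ i - apply_bcontfun (fst p) (snd (snd p)) $ i\<bar> \<le> s)}"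
    by (intro closed_Collect_conj closed_Collect_all closed_Collect_le continuous_intros)
  have eq: "{(f :: unit_interval \<Rightarrow>\<^sub>C (real^'d), z). z \<in> near_pairs s f} = {p.
      dist (fst (snd p)) (snd (snd p)) \<le> s \<and>
      (\<forall>i. \<bar>apply_bcontfun (fst p) (fst (snd p)) $ i - apply_bcontfun (fst p) (snd (snd p)) $ i\<bar> \<le> s)}"
    by (auto simp: near_pairs_def)
  have "{(f :: unit_interval \<Rightarrow>\<^sub>C (real^'d), z). z \<in> near_pairs s f} \<in> sets borel"
    unfolding eq using cl by (rule borel_closed)
  then show ?thesis
    by (simp add: sets_unit_lebesgue_pair borel_prod[symmetric] cong: sets_pair_measure_cong)
qed

lemma near_pairs_sets [measurable]: "near_pairs s f \<in> sets (unit_lebesgue \<Otimes>\<^sub>M unit_lebesgue)"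
  using sets_Pair1[OF near_pairs_measurable, of f s] by (simp add: vimage_def)

section \<open>Coverings of a graph with few near pairs\<close>

definition cell :: "real \<Rightarrow> real \<times> (real^'d) \<Rightarrow> int \<times> ('d \<Rightarrow> int)" where
  "cell s p = (\<lfloor>fst p / s\<rfloor>, \<lambda>i. \<lfloor>snd p $ i / s\<rfloor>)"

lemma card_floor_interval_le:
  fixes s t v :: real
  assumes "0 < s" "s \<le> t"
  shows "real (card {\<lfloor>(v - t) / s\<rfloor>..\<lfloor>(v + t) / s\<rfloor>}) \<le> 4 * t / s"
proof -
  have "0 \<le> \<lfloor>(v + t) / s\<rfloor> - \<lfloor>(v - t) / s\<rfloor>"
    using assms by (simp add: floor_mono divide_right_mono)
  then have "real (card {\<lfloor>(v - t) / s\<rfloor>..\<lfloor>(v + t) / s\<rfloor>}) = of_int (\<lfloor>(v + t) / s\<rfloor> - \<lfloor>(v - t) / s\<rfloor> + 1)"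
    by simp
  also have "\<dots> \<le> (v + t) / s - (v - t) / s + 2"
    by linarith
  also have "\<dots> = 2 * (t / s) + 2" using assms by (simp add: field_simps)
  \<comment> \<open>The rounding error 2 is absorbed because \<open>1 \<le> t / s\<close>.\<close>
  also have "\<dots> \<le> 4 * (t / s)" using assms by (simp add: field_simps)
  finally show ?thesis by simp
qed

text \<open>\<open>A\<close> lies in the cube of half-side \<open>diameter A\<close> around any of
  its points. The exponent counts the time coordinate and the coordinates of the values.\<close>

lemma cell_image_card_le:
  fixes A :: "(real \<times> (real^'d)) set"
  assumes "bounded A" "0 < s" "s \<le> diameter A"
  shows "finite (cell s ` A) \<and> real (card (cell s ` A)) \<le> (4 * diameter A / s) ^ (CARD('d) + 1)"
proof (cases "A = {}")
  case False
  then obtain p where p: "p \<in> A" by blast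
  define t where "t = diameter A"
  define I where "I v = {\<lfloor>(v - t) / s\<rfloor>..\<lfloor>(v + t) / s\<rfloor>}" for v
  have fl: "\<lfloor>w / s\<rfloor> \<in> I v" if "\<bar>w - v\<bar> \<le> t" for v w
    unfolding I_def using that assms(2) by (auto intro!: floor_mono divide_right_mono)
  define Q where "Q = I (fst p) \<times> PiE UNIV (\<lambda>i. I (snd p $ i))"
  have sub: "cell s ` A \<subseteq> Q"
  proof (rule image_subsetI)
    fix z assume z: "z \<in> A"
    obtain x y where xy: "z = (x, y)" by (cases z)
    with z have d: "dist (x, y) p \<le> t"
      unfolding t_def using p assms(1) diameter_bounded_bound by blast
    have "\<bar>x - fst p\<bar> \<le> t"
      using dist_fst_le[of "(x, y)" p] d by (simp add: dist_real_def)
    moreover have "\<bar>y $ i - snd p $ i\<bar> \<le> t" for i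
      using dist_snd_le[of "(x, y)" p] d component_le_norm_cart[of "y - snd p" i]
      by (simp add: dist_norm)
    ultimately show "cell s z \<in> Q"
      using fl by (auto simp: xy cell_def Q_def PiE_def)
  qed
  have fin: "finite Q" unfolding Q_def I_def by (intro finite_cartesian_product finite_PiE) auto
  have ci: "real (card (I v)) \<le> 4 * t / s" for v
    unfolding I_def using assms by (intro card_floor_interval_le) (auto simp: t_def)
  have "real (card (cell s ` A)) \<le> real (card Q)"
    using card_mono[OF fin sub] by simp
  also have "\<dots> = real (card (I (fst p))) * (\<Prod>i\<in>UNIV. real (card (I (snd p $ i))))"
    unfolding Q_def by (simp add: card_cartesian_product card_PiE)
  also have "\<dots> \<le> (4 * t / s) * (\<Prod>i\<in>(UNIV::'d set). 4 * t / s)"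
    using assms by (intro mult_mono prod_mono ci conjI prod_nonneg) (auto simp: t_def)
  finally show ?thesis using finite_subset[OF sub fin] by (simp add: t_def)
qed (use assms in auto)

lemma cell_measurable:
  fixes f :: "unit_interval \<Rightarrow>\<^sub>C (real^'d)"
  shows "{x. cell s (real_of_unit x, f x) = q} \<in> sets borel"
proof -
  have [measurable]: "real_of_unit \<in> borel_measurable borel"
    by (intro borel_measurable_continuous_onI continuous_on_real_of_unit)
  have [measurable]: "(\<lambda>x. f x $ i) \<in> borel_measurable borel" for i
    by (intro borel_measurable_continuous_onI continuous_intros)
  have "{x. cell s (real_of_unit x, f x) = q} =
    {x \<in> space borel. \<lfloor>real_of_unit x / s\<rfloor> = fst q \<and> (\<forall>i. \<lfloor>f x $ i / s\<rfloor> = snd q i)}"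
    by (auto simp: cell_def)
  also have "\<dots> \<in> sets borel" by measurable
  finally show ?thesis .
qed

text \<open>Cauchy--Schwarz over the cells: two points in the same cell form a near pair.\<close>

lemma measure_cells_le:
  fixes f :: "unit_interval \<Rightarrow>\<^sub>C (real^'d)"
  assumes "finite Q" "0 < s"
  shows "(measure unit_lebesgue {x. cell s (real_of_unit x, f x) \<in> Q})\<^sup>2
    \<le> real (card Q) * measure (unit_lebesgue \<Otimes>\<^sub>M unit_lebesgue) (near_pairs s f)"
proof -
  define E where "E q = {x. cell s (real_of_unit x, f x) = q}" for q
  have E[measurable]: "E q \<in> sets unit_lebesgue" for q unfolding E_def using cell_measurable by simp
  then have sE: "E ` Q \<subseteq> sets unit_lebesgue" by blast
  have dE: "disjoint_family_on E Q" by (auto simp: disjoint_family_on_def E_def)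
  have "{x. cell s (real_of_unit x, f x) \<in> Q} = (\<Union>q\<in>Q. E q)" by (auto simp: E_def)
  then have "measure unit_lebesgue {x. cell s (real_of_unit x, f x) \<in> Q} = (\<Sum>q\<in>Q. measure unit_lebesgue (E q))"
    using unit_lebesgue.finite_measure_finite_Union[OF assms(1) sE dE] by metis
  then have "(measure unit_lebesgue {x. cell s (real_of_unit x, f x) \<in> Q})\<^sup>2
     \<le> (\<Sum>q\<in>Q. (measure unit_lebesgue (E q))\<^sup>2) * real (card Q)"
    using sum_squared_le_sum_of_squares[of "\<lambda>q. measure unit_lebesgue (E q)" Q] by (simp add: mult.commute)
  \<comment> \<open>A squared mass is the mass of a product square; the squares of distinct cells
    are disjoint and consist of near pairs.\<close>
  moreover have "(\<Sum>q\<in>Q. (measure unit_lebesgue (E q))\<^sup>2)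
      = (\<Sum>q\<in>Q. measure (unit_lebesgue \<Otimes>\<^sub>M unit_lebesgue) (E q \<times> E q))"
    by (intro sum.cong refl) (simp add: E[unfolded sets_unit_lebesgue] measure_def unit_lebesgue.emeasure_pair_measure_Times enn2real_mult power2_eq_square)
  moreover have "\<dots> = measure (unit_lebesgue \<Otimes>\<^sub>M unit_lebesgue) (\<Union>q\<in>Q. E q \<times> E q)"
    using assms(1) E
    by (intro unit_lebesgue_pair.finite_measure_finite_Union[symmetric])
      (auto simp: disjoint_family_on_def E_def intro!: pair_measureI)
  moreover have "\<dots> \<le> measure (unit_lebesgue \<Otimes>\<^sub>M unit_lebesgue) (near_pairs s f)"
  proof (intro unit_lebesgue_pair.finite_measure_mono near_pairs_sets)
    have fl: "\<bar>u - v\<bar> \<le> s" if "\<lfloor>u / s\<rfloor> = \<lfloor>v / s\<rfloor>" for u v :: real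
    proof -
      have "\<bar>u / s - v / s\<bar> \<le> 1" using that by linarith
      then have "\<bar>u - v\<bar> / s \<le> 1" using assms by (simp add: diff_divide_distrib[symmetric])
      then show ?thesis using assms by (simp add: field_simps)
    qed
    show "(\<Union>q\<in>Q. E q \<times> E q) \<subseteq> near_pairs s f"
      using fl by (auto simp: E_def cell_def near_pairs_def dist_unit_interval_def dist_real_def fun_eq_iff)
  qed
  ultimately show ?thesis
    by (smt (verit, best) mult.commute mult_left_mono of_nat_0_le_iff)
qed

section \<open>Lower bound for the gauge sum of a covering\<close>

lemma gauge_function_nonneg: "gauge_function \<psi> \<Longrightarrow> 0 \<le> r \<Longrightarrow> 0 \<le> \<psi> r"
  unfolding gauge_function_def by (metis atLeast_iff mono_onD order_refl)

text \<open>The deterministic half of the argument. The factor \<open>8 ^ n\<close> in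
  \<open>growth\<close> exceeds the loss \<open>2 ^ n\<close> in \<open>near\<close> by
  \<open>4 ^ n\<close>; after the square root from Cauchy-Schwarz, level \<open>n\<close> carries
  mass of order \<open>(1 / 2) ^ n\<close>, which is summable.\<close>

lemma hausdorff_pre_graph_ge:
  fixes f :: "unit_interval \<Rightarrow>\<^sub>C (real^'d)" and s c :: "nat \<Rightarrow> real"
  assumes gauge: "gauge_function \<psi>"
    and s_pos: "\<And>n. 0 < s n" and s_lim: "s \<longlonglongrightarrow> 0"
    and c_pos: "\<And>n. 0 < c n"
    and growth: "\<And>n r. 0 < r \<Longrightarrow> r \<le> s n \<Longrightarrow> 8 ^ n * c n * r ^ (CARD('d) + 1) \<le> \<psi> r"
    and near: "\<And>n. measure (unit_lebesgue \<Otimes>\<^sub>M unit_lebesgue) (near_pairs (s (Suc n)) f)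
      \<le> L * 2 ^ n * c n * s (Suc n) ^ (CARD('d) + 1)"
    and "0 < L"
  shows "ennreal (1 / (4 * 4 ^ (CARD('d) + 1) * L)) \<le> hausdorff_pre \<psi> (s 0) (graph_of f)"
  unfolding hausdorff_pre_def
proof (rule INF_greatest, rule ccontr)
  fix A :: "nat \<Rightarrow> (real \<times> (real^'d)) set"
  define D where "D = CARD('d) + 1"
  \<comment> \<open>Chosen so that \<open>S < \<kappa>\<close> forces \<open>2 * K < 1\<close> for
    the \<open>K\<close> below, although the covered mass is 1.\<close>
  define \<kappa> where "\<kappa> = 1 / (4 * 4 ^ D * L)"
  define t where "t i = diameter (A i)" for i
  assume "A \<in> {A. graph_of f \<subseteq> (\<Union>i. A i) \<and> (\<forall>i. bounded (A i) \<and> diameter (A i) \<le> s 0)}"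
  then have cover: "graph_of f \<subseteq> (\<Union>i. A i)" and bdd: "\<And>i. bounded (A i)" and t_le: "\<And>i. t i \<le> s 0"
    by (auto simp: t_def)
  assume "\<not> ennreal (1 / (4 * 4 ^ (CARD('d) + 1) * L)) \<le> (\<Sum>i. ennreal (\<psi> (diameter (A i))))"
  then have lt: "(\<Sum>i. ennreal (\<psi> (t i))) < ennreal \<kappa>"
    by (simp add: \<kappa>_def D_def t_def not_le)
  have t_ge: "0 \<le> t i" for i unfolding t_def by (rule diameter_ge_0[OF bdd])
  have \<psi>_ge: "0 \<le> \<psi> (t i)" for i by (rule gauge_function_nonneg[OF gauge t_ge])
  have summ: "summable (\<lambda>i. \<psi> (t i))"
    using lt \<psi>_ge by (intro summable_suminf_not_top) (auto simp: top_unique)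
  define S where "S = (\<Sum>i. \<psi> (t i))"
  have S: "0 \<le> S" "S < \<kappa>"
  proof -
    show "0 \<le> S" unfolding S_def by (intro suminf_nonneg summ \<psi>_ge)
    then show "S < \<kappa>"
      using lt suminf_ennreal2[OF \<psi>_ge summ] by (simp add: S_def[symmetric] ennreal_less_iff)
  qed
  \<comment> \<open>Sets of level \<open>n\<close> are larger than the cell side
    \<open>s (Suc n)\<close>, so the cell count applies, and at most \<open>s n\<close>, so the
    growth condition applies.\<close>
  define I where "I n = {i. s (Suc n) < t i \<and> t i \<le> s n}" for n
  define Q where "Q n = (\<Union>i\<in>I n. cell (s (Suc n)) ` A i)" for n
  define E where "E n = {x. cell (s (Suc n)) (real_of_unit x, f x) \<in> Q n}" for n
  \<comment> \<open>By monotonicity every set of level \<open>n\<close> contributes at least the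
    positive value \<open>\<psi> (s (Suc n))\<close> to a convergent series.\<close>
  have fin: "finite (I n)" for n
  proof -
    have "0 < 8 ^ Suc n * c (Suc n) * s (Suc n) ^ D" using c_pos s_pos by simp
    also have "\<dots> \<le> \<psi> (s (Suc n))" unfolding D_def by (rule growth) (auto simp: s_pos)
    finally have pos: "0 < \<psi> (s (Suc n))" .
    have "\<forall>\<^sub>F i in sequentially. \<psi> (t i) < \<psi> (s (Suc n))"
      using summable_LIMSEQ_zero[OF summ] pos by (rule order_tendstoD)
    then obtain N where N: "\<And>i. N \<le> i \<Longrightarrow> \<psi> (t i) < \<psi> (s (Suc n))"
      by (auto simp: eventually_sequentially)
    have "I n \<subseteq> {..<N}"
    proof
      fix i assume "i \<in> I n"
      then have "\<psi> (s (Suc n)) \<le> \<psi> (t i)"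
        using gauge s_pos[of "Suc n"] unfolding gauge_function_def I_def
        by (auto intro: mono_onD)
      then show "i \<in> {..<N}" using N by (meson lessThan_iff not_le)
    qed
    then show ?thesis by (rule finite_subset) simp
  qed
  have finQ: "finite (Q n)" for n
    unfolding Q_def using cell_image_card_le[OF bdd s_pos] fin
    by (intro finite_UN_I) (auto simp: I_def t_def)
  \<comment> \<open>A set of diameter \<open>t i\<close> meets at most
    \<open>(4 * t i / s (Suc n)) ^ D\<close> cells, and \<open>growth\<close> trades
    \<open>t i ^ D\<close> for \<open>\<psi> (t i)\<close>.\<close>
  have cardQ: "real (card (Q n)) \<le> 4 ^ D * S / (8 ^ n * c n * s (Suc n) ^ D)" for n
  proof -
    have "real (card (Q n)) \<le> (\<Sum>i\<in>I n. real (card (cell (s (Suc n)) ` A i)))"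
      using card_UN_le[OF fin[of n], of "\<lambda>i. cell (s (Suc n)) ` A i"] unfolding Q_def
      by (simp flip: of_nat_sum)
    also have "\<dots> \<le> (\<Sum>i\<in>I n. (4 * t i / s (Suc n)) ^ D)"
      unfolding t_def D_def
      using cell_image_card_le[OF bdd s_pos] by (intro sum_mono) (auto simp: I_def t_def)
    also have "\<dots> \<le> (\<Sum>i\<in>I n. (4 / s (Suc n)) ^ D / (8 ^ n * c n) * \<psi> (t i))"
    proof (intro sum_mono)
      fix i assume "i \<in> I n"
      then have "0 < t i" "t i \<le> s n" using s_pos[of "Suc n"] by (auto simp: I_def)
      then have "8 ^ n * c n * t i ^ D \<le> \<psi> (t i)" unfolding D_def by (rule growth)
      then have "t i ^ D \<le> \<psi> (t i) / (8 ^ n * c n)"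
        using c_pos[of n] by (simp add: field_simps)
      then have "(4 / s (Suc n)) ^ D * t i ^ D \<le> (4 / s (Suc n)) ^ D * (\<psi> (t i) / (8 ^ n * c n))"
        using s_pos[of "Suc n"] by (intro mult_left_mono) auto
      then show "(4 * t i / s (Suc n)) ^ D \<le> (4 / s (Suc n)) ^ D / (8 ^ n * c n) * \<psi> (t i)"
        by (simp add: power_divide power_mult_distrib mult_ac)
    qed
    also have "\<dots> \<le> (4 / s (Suc n)) ^ D / (8 ^ n * c n) * S"
      unfolding sum_distrib_left[symmetric] S_def
      using c_pos[of n] s_pos[of "Suc n"] fin \<psi>_ge summ
      by (intro mult_left_mono sum_le_suminf) (auto intro!: divide_nonneg_pos mult_pos_pos)
    also have "\<dots> = 4 ^ D * S / (8 ^ n * c n * s (Suc n) ^ D)"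
      by (simp add: power_divide mult_ac)
    finally show ?thesis .
  qed
  define K where "K = sqrt (4 ^ D * S * L)"
  have "0 \<le> K" unfolding K_def using S \<open>0 < L\<close> by simp
  have measE: "measure unit_lebesgue (E n) \<le> K * (1 / 2) ^ n" for n
  proof -
    have "(measure unit_lebesgue (E n))\<^sup>2
        \<le> real (card (Q n)) * measure (unit_lebesgue \<Otimes>\<^sub>M unit_lebesgue) (near_pairs (s (Suc n)) f)"
      unfolding E_def by (intro measure_cells_le finQ s_pos)
    also have "\<dots> \<le> (4 ^ D * S / (8 ^ n * c n * s (Suc n) ^ D)) * (L * 2 ^ n * c n * s (Suc n) ^ D)"
      using near[of n] cardQ[of n] S c_pos[of n] s_pos[of "Suc n"] unfolding D_def
      by (intro mult_mono) (auto intro!: divide_nonneg_pos mult_pos_pos)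
    also have "\<dots> = 4 ^ D * S * L * (2 / 8) ^ n"
    proof -
      have "(8 :: real) ^ n = 2 ^ n * 4 ^ n" by (simp flip: power_mult_distrib)
      then show ?thesis using c_pos[of n] s_pos[of "Suc n"] by (simp add: power_divide)
    qed
    also have "\<dots> = K\<^sup>2 * ((1 / 2) ^ n)\<^sup>2"
    proof -
      have "(1 / 4 :: real) ^ n = (1 / 2) ^ n * (1 / 2) ^ n" by (simp flip: power_mult_distrib)
      then show ?thesis using S \<open>0 < L\<close> by (simp add: K_def power2_eq_square)
    qed
    also have "\<dots> = (K * (1 / 2) ^ n)\<^sup>2" by (simp add: power_mult_distrib)
    finally show ?thesis by (rule power2_le_imp_le) (use \<open>0 \<le> K\<close> in simp)
  qed
  \<comment> \<open>Sets of diameter 0 belong to no level; each contains at most one point, so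
    together they cover only countably many \<open>x\<close>.\<close>
  define Z where "Z = {x. \<exists>i. t i = 0 \<and> (real_of_unit x, f x) \<in> A i}"
  have "countable Z"
  proof -
    have "Z \<subseteq> (\<Union>i. (\<lambda>p. unit_of_real (fst p)) ` {p. p \<in> A i \<and> t i = 0})"
    proof
      fix x assume "x \<in> Z"
      then obtain i where i: "(real_of_unit x, f x) \<in> {p. p \<in> A i \<and> t i = 0}" by (auto simp: Z_def)
      have "x = unit_of_real (fst (real_of_unit x, f x))" by (simp add: real_of_unit_inverse)
      then show "x \<in> (\<Union>i. (\<lambda>p. unit_of_real (fst p)) ` {p. p \<in> A i \<and> t i = 0})"
        by (intro UN_I[of i] image_eqI[OF _ i]) auto
    qed
    moreover have "countable {p. p \<in> A i \<and> t i = 0}" for i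
    proof (cases "\<exists>p. p \<in> A i \<and> t i = 0")
      case True
      then obtain p where p: "p \<in> A i" "t i = 0" by blast
      have "{p. p \<in> A i \<and> t i = 0} \<subseteq> {p}"
      proof
        fix q assume "q \<in> {p. p \<in> A i \<and> t i = 0}"
        then have "dist q p \<le> t i" unfolding t_def using p by (intro diameter_bounded_bound bdd) auto
        then show "q \<in> {p}" using p by simp
      qed
      then show ?thesis by (rule countable_subset) simp
    next
      case False
      then have "{p. p \<in> A i \<and> t i = 0} = {}" by blast
      then show ?thesis by (simp only: countable_empty)
    qed
    ultimately show ?thesis
      by (meson countable_UN countable_image countable_subset countableI_type)
  qed
  have range: "\<exists>n. s (Suc n) < t i \<and> t i \<le> s n" if "t i \<noteq> 0" for i
  proof -
    have "0 < t i" using that t_ge[of i] by simp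
    with s_lim have "\<forall>\<^sub>F n in sequentially. s n < t i" by (rule order_tendstoD)
    then obtain m where "s m < t i" by (auto simp: eventually_sequentially)
    \<comment> \<open>The first scale below \<open>t i\<close>: it is not \<open>s 0\<close>, and
      its predecessor is at least \<open>t i\<close>. This works for any positive null sequence of
      scales.\<close>
    define k where "k = (LEAST k. s k < t i)"
    have k: "s k < t i" unfolding k_def by (rule LeastI) fact
    then have "k \<noteq> 0" using t_le[of i] by (cases k) auto
    then obtain n where n: "k = Suc n" by (cases k) auto
    then have "\<not> s n < t i" unfolding k_def using not_less_Least by (metis lessI)
    with k n show ?thesis by auto
  qed
  have "UNIV \<subseteq> (\<Union>n. E n) \<union> Z"
  proof
    fix x
    have "(real_of_unit x, f x) \<in> graph_of f" by (auto simp: graph_of_def)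
    then obtain i where i: "(real_of_unit x, f x) \<in> A i" using cover by blast
    show "x \<in> (\<Union>n. E n) \<union> Z"
    proof (cases "t i = 0")
      case False
      then obtain n where "i \<in> I n" using range[of i] by (auto simp: I_def)
      then have "x \<in> E n" using i by (auto simp: E_def Q_def)
      then show ?thesis by blast
    qed (use i in \<open>auto simp: Z_def\<close>)
  qed
  moreover have E_sets [measurable]: "E n \<in> sets unit_lebesgue" for n
  proof -
    have "E n = (\<Union>q\<in>Q n. {x. cell (s (Suc n)) (real_of_unit x, f x) = q})" by (auto simp: E_def)
    also have "\<dots> \<in> sets unit_lebesgue"
      unfolding sets_unit_lebesgue by (intro sets.finite_UN finQ cell_measurable)
    finally show ?thesis .
  qed
  moreover have Z_sets: "Z \<in> sets unit_lebesgue"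
    by (rule sets.countable[OF _ \<open>countable Z\<close>]) simp
  ultimately have "emeasure unit_lebesgue UNIV \<le> emeasure unit_lebesgue ((\<Union>n. E n) \<union> Z)"
    by (intro emeasure_mono sets.Un sets.countable_UN) auto
  also have "\<dots> \<le> emeasure unit_lebesgue (\<Union>n. E n) + emeasure unit_lebesgue Z"
    using E_sets Z_sets by (intro emeasure_subadditive sets.countable_UN) auto
  also have "\<dots> = emeasure unit_lebesgue (\<Union>n. E n)"
    using countable_null_unit_lebesgue[OF \<open>countable Z\<close>] by simp
  also have "\<dots> \<le> (\<Sum>n. emeasure unit_lebesgue (E n))"
    using E_sets by (intro emeasure_subadditive_countably) auto
  also have "\<dots> \<le> (\<Sum>n. ennreal (K * (1 / 2) ^ n))"
    by (intro suminf_le) (auto simp: unit_lebesgue.emeasure_eq_measure intro!: ennreal_leI measE)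
  also have "\<dots> = ennreal (\<Sum>n. K * (1 / 2) ^ n)"
    using \<open>0 \<le> K\<close> by (intro suminf_ennreal2) (auto intro!: summable_mult summable_geometric)
  also have "(\<Sum>n. K * (1 / 2) ^ n) = 2 * K"
    by (subst suminf_mult) (auto simp: suminf_geometric)
  finally have "1 \<le> 2 * K"
    using unit_lebesgue.emeasure_space_1 \<open>0 \<le> K\<close> by simp
  then have "1 \<le> (2 * K)\<^sup>2" by (rule one_le_power)
  also have "\<dots> = 4 * 4 ^ D * L * S"
    using S \<open>0 < L\<close> by (simp add: K_def power_mult_distrib)
  also have "\<dots> < 4 * 4 ^ D * L * \<kappa>"
    using S \<open>0 < L\<close> by (intro mult_strict_left_mono) auto
  also have "\<dots> = 1" using \<open>0 < L\<close> by (simp add: \<kappa>_def)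
  finally show False by simp
qed

section \<open>The random function\<close>

text \<open>Completeness lets the series of layers converge in the uniform norm.\<close>

instance bcontfun :: (metric_space, banach) banach ..

section \<open>Tent functions and the random series\<close>

definition tent :: "real \<Rightarrow> real" where
  "tent y = max 0 (1 - \<bar>y\<bar>)"

lemma tent_nonneg: "0 \<le> tent y" and tent_le_1: "tent y \<le> 1"
  by (auto simp: tent_def)

lemma continuous_on_tent [continuous_intros]: "continuous_on S f \<Longrightarrow> continuous_on S (\<lambda>x. tent (f x))"
  unfolding tent_def by (intro continuous_intros)

text \<open>Only the integers \<open>\<lfloor>y\<rfloor>\<close> and
  \<open>\<lfloor>y\<rfloor> + 1\<close> can lie at distance less than 1 from \<open>y\<close>. The
  bound is independent of \<open>N\<close>, which leaves the number of nodes free.\<close>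

lemma sum_tent_le:
  assumes "0 \<le> y"
  shows "(\<Sum>j\<le>N. tent (y - real j)) \<le> 2"
proof -
  define A where "A = {nat \<lfloor>y\<rfloor>, Suc (nat \<lfloor>y\<rfloor>)}"
  have "tent (y - real j) = 0" if "j \<notin> A" for j
    using that assms unfolding A_def tent_def by (auto simp: max_def) linarith
  then have "(\<Sum>j\<le>N. tent (y - real j)) = (\<Sum>j\<in>{..N} \<inter> A. tent (y - real j))"
    by (intro sum.mono_neutral_right) auto
  also have "\<dots> \<le> (\<Sum>j\<in>{..N} \<inter> A. 1)" by (intro sum_mono tent_le_1)
  also have "\<dots> \<le> real (card A)" using card_mono[of A "{..N} \<inter> A"] by (simp add: A_def)
  also have "\<dots> \<le> 2" by (simp add: A_def)
  finally show ?thesis .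
qed

text \<open>The tent with peak \<open>v\<close> at the node \<open>j / N\<close>, supported within
  distance \<open>1 / N\<close> of it.\<close>

definition bump :: "nat \<Rightarrow> nat \<Rightarrow> 'b::real_normed_vector \<Rightarrow> (unit_interval \<Rightarrow>\<^sub>C 'b)" where
  "bump N j v = Bcontfun (\<lambda>x. tent (real N * real_of_unit x - real j) *\<^sub>R v)"

lemma apply_bump: "bump N j v x = tent (real N * real_of_unit x - real j) *\<^sub>R v"
  unfolding bump_def
  by (subst Bcontfun_inverse) (auto intro!: continuous_imp_bcontfun continuous_intros continuous_on_real_of_unit)

lemma bump_0 [simp]: "bump N j 0 = 0"
  by (rule bcontfun_eqI) (simp add: apply_bump)

text \<open>The map is 1-Lipschitz since tents take values in [0,1]; this yields measurability of
  the random function.\<close>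

lemma continuous_on_bump: "continuous_on UNIV (bump N j)"
proof -
  have "dist (bump N j v) (bump N j w) \<le> dist v w" for v w :: 'a
    by (rule dist_bound)
      (simp add: apply_bump dist_norm tent_nonneg tent_le_1 mult_left_le_one_le flip: scaleR_diff_right)
  then show ?thesis
    unfolding continuous_on_iff by (meson le_less_trans)
qed

text \<open>Truncating bounds every sample, so that the random series converges everywhere and not only
  almost surely.\<close>

definition truncate :: "real^'d \<Rightarrow> real^'d" where
  "truncate u = (if u \<in> cbox 0 1 then u else 0)"

lemma truncate_0 [simp]: "truncate 0 = 0"
  by (simp add: truncate_def)

lemma truncate_measurable [measurable]: "truncate \<in> borel_measurable borel"
  unfolding truncate_def[abs_def] by measurable

lemma norm_truncate_le: "norm (truncate u :: real^'d) \<le> CARD('d)"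
proof -
  have "norm (truncate u) \<le> (\<Sum>i\<in>UNIV. \<bar>truncate u $ i\<bar>)" by (rule norm_le_l1_cart)
  also have "\<dots> \<le> (\<Sum>i\<in>(UNIV::'d set). 1)"
    by (intro sum_mono) (auto simp: truncate_def mem_box_cart)
  finally show ?thesis by simp
qed

definition layer :: "(nat \<Rightarrow> nat) \<Rightarrow> nat \<Rightarrow> (nat \<times> nat \<Rightarrow> real^'d) \<Rightarrow> (unit_interval \<Rightarrow>\<^sub>C (real^'d))" where
  "layer N n w = (1 / 2) ^ n *\<^sub>R (\<Sum>j\<le>N n. bump (N n) j (truncate (w (n, j))))"

definition random_fun :: "(nat \<Rightarrow> nat) \<Rightarrow> (nat \<times> nat \<Rightarrow> real^'d) \<Rightarrow> (unit_interval \<Rightarrow>\<^sub>C (real^'d))" where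
  "random_fun N w = (\<Sum>n. layer N n w)"

lemma apply_bcontfun_sum:
  fixes f :: "'c \<Rightarrow> 'a::topological_space \<Rightarrow>\<^sub>C 'b::real_normed_vector"
  shows "apply_bcontfun (\<Sum>j\<in>A. f j) x = (\<Sum>j\<in>A. apply_bcontfun (f j) x)"
  by (induction A rule: infinite_finite_induct) auto

text \<open>The tents at one point have total weight at most 2 and truncated coefficients are
  bounded, so the weights \<open>(1 / 2) ^ n\<close> dominate the norms for every \<open>w\<close>
  and every choice of \<open>N\<close>.\<close>

lemma summable_layer: "summable (\<lambda>n. layer N n (w :: nat \<times> nat \<Rightarrow> real^'d))"
proof (rule summable_comparison_test')
  show "summable (\<lambda>n. 2 * real CARD('d) * (1 / 2) ^ n)"
    by (intro summable_mult summable_geometric) simp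
  show "norm (layer N n w) \<le> 2 * real CARD('d) * (1 / 2) ^ n" if "n \<ge> 0" for n
  proof -
    have "norm (\<Sum>j\<le>N n. bump (N n) j (truncate (w (n, j)))) \<le> 2 * real CARD('d)"
    proof (rule norm_bound)
      fix x
      let ?y = "real (N n) * real_of_unit x"
      have "norm (apply_bcontfun (\<Sum>j\<le>N n. bump (N n) j (truncate (w (n, j)))) x)
        \<le> (\<Sum>j\<le>N n. tent (?y - real j) * norm (truncate (w (n, j))))"
        unfolding apply_bcontfun_sum apply_bump
        by (rule sum_norm_le) (simp add: tent_nonneg)
      also have "\<dots> \<le> (\<Sum>j\<le>N n. tent (?y - real j) * real CARD('d))"
        by (intro sum_mono mult_left_mono norm_truncate_le tent_nonneg)
      also have "\<dots> \<le> 2 * real CARD('d)"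
        unfolding sum_distrib_right[symmetric]
        using real_of_unit[of x] by (intro mult_right_mono sum_tent_le) auto
      finally show "norm (apply_bcontfun (\<Sum>j\<le>N n. bump (N n) j (truncate (w (n, j)))) x) \<le> 2 * real CARD('d)" .
    qed
    then show ?thesis unfolding layer_def by (simp add: mult_ac)
  qed
qed

text \<open>One coefficient enters a single summand of a single layer. The reference value 0
  contributes nothing, as \<open>truncate 0 = 0\<close> and \<open>bump N j 0 = 0\<close>.\<close>

lemma random_fun_upd:
  assumes "j \<le> N n"
  shows "random_fun N (w((n, j) := u))
    = random_fun N (w((n, j) := 0)) + (1 / 2) ^ n *\<^sub>R bump (N n) j (truncate u)"
proof -
  have "layer N m (w((n, j) := u)) - layer N m (w((n, j) := 0))
      = (if m = n then (1 / 2) ^ n *\<^sub>R bump (N n) j (truncate u) else 0)" for m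
  proof (cases "m = n")
    case True
    have eq: "bump (N n) i (truncate ((w((n, j) := u)) (n, i))) - bump (N n) i (truncate ((w((n, j) := 0)) (n, i)))
      = (if i = j then bump (N n) j (truncate u) else 0)" for i
      by auto
    show ?thesis
      unfolding layer_def True scaleR_diff_right[symmetric] sum_subtractf[symmetric] eq
      using assms by (simp add: sum.delta)
  qed (simp add: layer_def)
  then have "(\<lambda>m. layer N m (w((n, j) := u)) - layer N m (w((n, j) := 0)))
      sums ((1 / 2) ^ n *\<^sub>R bump (N n) j (truncate u))"
    using sums_If_finite_set[of "{n}" "\<lambda>_. (1 / 2) ^ n *\<^sub>R bump (N n) j (truncate u)"] by simp
  moreover have "(\<lambda>m. layer N m (w((n, j) := u)) - layer N m (w((n, j) := 0)))
      sums (random_fun N (w((n, j) := u)) - random_fun N (w((n, j) := 0)))"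
    unfolding random_fun_def by (intro sums_diff summable_sums summable_layer)
  ultimately have "random_fun N (w((n, j) := u)) - random_fun N (w((n, j) := 0))
      = (1 / 2) ^ n *\<^sub>R bump (N n) j (truncate u)"
    by (rule sums_unique2[rotated])
  then show ?thesis by (simp add: diff_eq_eq add.commute)
qed

section \<open>Independent uniform coefficients and resampling\<close>

definition cube_measure :: "(real^'d) measure" where
  "cube_measure = uniform_measure lborel (cbox 0 1)"

definition noise :: "(nat \<times> nat \<Rightarrow> real^'d) measure" where
  "noise = Pi\<^sub>M UNIV (\<lambda>_. cube_measure)"

lemma sets_cube_measure [simp, measurable_cong]: "sets cube_measure = sets borel"
  and space_cube_measure [simp]: "space cube_measure = UNIV"
  by (simp_all add: cube_measure_def)

lemma emeasure_unit_cube: "emeasure lborel (cbox 0 1 :: (real^'d) set) = 1"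
proof -
  have "(1 :: real^'d) \<bullet> b = 1" if "b \<in> Basis" for b
    using that by (auto simp: Basis_vec_def inner_axis)
  then show ?thesis by (subst emeasure_lborel_cbox) auto
qed

lemma prob_space_cube_measure: "prob_space (cube_measure :: (real^'d) measure)"
  unfolding cube_measure_def by (rule prob_space_uniform_measure) (simp_all add: emeasure_unit_cube)

interpretation cube_measure: prob_space "cube_measure :: (real^'d) measure"
  by (rule prob_space_cube_measure)

lemma prob_space_noise: "prob_space (noise :: (nat \<times> nat \<Rightarrow> real^'d) measure)"
  unfolding noise_def by (rule prob_space_PiM) (rule prob_space_cube_measure)

interpretation noise: prob_space "noise :: (nat \<times> nat \<Rightarrow> real^'d) measure"
  by (rule prob_space_noise)

lemma space_noise [simp]: "space noise = UNIV"
  by (simp add: noise_def space_PiM)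

text \<open>On the unit cube truncation is the identity, and the condition confines \<open>u\<close>
  to a box of side \<open>2 * s / c\<close>. The cube has volume 1, so volume bounds
  probability.\<close>

lemma cube_measure_small_ball:
  fixes e :: "real^'d"
  assumes "0 < c" "0 \<le> s"
  shows "emeasure cube_measure {u. \<forall>i. \<bar>c * truncate u $ i + e $ i\<bar> \<le> s} \<le> ennreal ((2 * s / c) ^ CARD('d))"
proof -
  define lo hi :: "real^'d" where "lo = (\<chi> i. (- s - e $ i) / c)" and "hi = (\<chi> i. (s - e $ i) / c)"
  have B: "(hi - lo) \<bullet> b = 2 * s / c" if "b \<in> Basis" for b
    using that by (auto simp: Basis_vec_def inner_axis lo_def hi_def diff_divide_distrib)
  have "0 \<le> 2 * s / c" using assms by simp
  then have le: "lo \<bullet> b \<le> hi \<bullet> b" if "b \<in> Basis" for b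
    using B[OF that] unfolding inner_diff_left by linarith
  have "emeasure cube_measure {u. \<forall>i. \<bar>c * truncate u $ i + e $ i\<bar> \<le> s}
    = emeasure lborel (cbox 0 1 \<inter> {u. \<forall>i. \<bar>c * truncate u $ i + e $ i\<bar> \<le> s})"
  proof -
    have "{u \<in> space borel. \<forall>i. \<bar>c * truncate u $ i + e $ i\<bar> \<le> s} \<in> sets borel"
      by measurable
    then show ?thesis
      unfolding cube_measure_def by (subst emeasure_uniform_measure) (simp_all add: emeasure_unit_cube divide_ennreal_def)
  qed
  also have "\<dots> \<le> emeasure lborel (cbox lo hi)"
  proof (intro emeasure_mono subsetI)
    fix u assume u: "u \<in> cbox 0 1 \<inter> {u. \<forall>i. \<bar>c * truncate u $ i + e $ i\<bar> \<le> s}"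
    then have "\<bar>c * u $ i + e $ i\<bar> \<le> s" for i by (auto simp: truncate_def)
    then have "- s - e $ i \<le> u $ i * c" "u $ i * c \<le> s - e $ i" for i
      by (smt (verit) mult.commute)+
    then show "u \<in> cbox lo hi"
      using assms by (auto simp: mem_box_cart lo_def hi_def divide_le_eq le_divide_eq)
  qed simp
  also have "\<dots> = ennreal ((2 * s / c) ^ CARD('d))"
    using emeasure_lborel_cbox[OF le] B by simp
  finally show ?thesis .
qed

lemma random_fun_measurable [measurable]: "random_fun N \<in> borel_measurable noise"
proof -
  have [measurable]: "(\<lambda>w :: nat \<times> nat \<Rightarrow> real^'d. w p) \<in> borel_measurable noise" for p
    unfolding noise_def using measurable_component_singleton[of p UNIV "\<lambda>_. cube_measure"] by simp
  have [measurable]: "bump M j \<in> borel_measurable borel" for M j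
    by (intro borel_measurable_continuous_onI continuous_on_bump)
  show ?thesis
    unfolding random_fun_def[abs_def] layer_def by measurable
qed

text \<open>Replacing one coordinate by an independent copy preserves the product law; Fubini then
  integrates over the new coordinate first, with all others frozen.\<close>

lemma noise_resample:
  assumes "G \<in> sets noise"
  shows "emeasure noise G = (\<integral>\<^sup>+w. emeasure cube_measure {u. w(p := u) \<in> G} \<partial>noise)"
proof -
  interpret pair_sigma_finite cube_measure noise ..
  have eq: "distr (cube_measure \<Otimes>\<^sub>M noise) noise (\<lambda>(u, w). w(p := u)) = noise"
    unfolding noise_def
    using distr_pair_PiM_eq_PiM[of UNIV "\<lambda>_. cube_measure" p] prob_space_cube_measure by simp
  have m: "(\<lambda>(u, w). w(p := u)) \<in> cube_measure \<Otimes>\<^sub>M noise \<rightarrow>\<^sub>M noise"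
    unfolding noise_def
    by (auto simp: split_beta' intro!: measurable_fun_upd[where J = UNIV])
  have "emeasure noise G = emeasure (distr (cube_measure \<Otimes>\<^sub>M noise) noise (\<lambda>(u, w). w(p := u))) G"
    by (simp only: eq)
  also have "\<dots> = emeasure (cube_measure \<Otimes>\<^sub>M noise) ((\<lambda>(u, w). w(p := u)) -` G \<inter> space (cube_measure \<Otimes>\<^sub>M noise))"
    by (rule emeasure_distr[OF m assms])
  also have "\<dots> = (\<integral>\<^sup>+w. emeasure cube_measure {u. w(p := u) \<in> G} \<partial>noise)"
    using measurable_sets[OF m assms]
    by (subst emeasure_pair_measure_alt2) (auto simp: space_pair_measure vimage_def)
  finally show ?thesis .
qed

section \<open>Small increments and the expected measure of near pairs\<close>

lemma near_values_sets:
  fixes g :: "unit_interval \<Rightarrow>\<^sub>C (real^'d)"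
  shows "{w. \<forall>i. \<bar>(random_fun N w + g) x $ i - (random_fun N w + g) y $ i\<bar> \<le> s} \<in> sets noise"
proof -
  have [measurable]: "(\<lambda>f :: unit_interval \<Rightarrow>\<^sub>C (real^'d). (f + g) z $ i) \<in> borel_measurable borel" for z i
    by (intro borel_measurable_continuous_onI continuous_intros)
  have "{w \<in> space noise. \<forall>i. \<bar>(random_fun N w + g) x $ i - (random_fun N w + g) y $ i\<bar> \<le> s} \<in> sets noise"
    by measurable
  then show ?thesis by simp
qed

text \<open>Resampling the single coefficient of a node close to \<open>x\<close> and far from \<open>y\<close>
  already spreads out the increment.\<close>

lemma prob_near_values_le:
  fixes g :: "unit_interval \<Rightarrow>\<^sub>C (real^'d)" and N :: "nat \<Rightarrow> nat"
  assumes "0 < N n" "2 / real (N n) < dist x y" "0 \<le> s"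
  shows "emeasure noise {w. \<forall>i. \<bar>(random_fun N w + g) x $ i - (random_fun N w + g) y $ i\<bar> \<le> s}
    \<le> ennreal ((4 * s * 2 ^ n) ^ CARD('d))"
proof -
  define G where "G = {w. \<forall>i. \<bar>(random_fun N w + g) x $ i - (random_fun N w + g) y $ i\<bar> \<le> s}"
  define a b where "a = real (N n) * real_of_unit x" and "b = real (N n) * real_of_unit y"
  \<comment> \<open>The node nearest to \<open>x\<close>, in units of the node spacing.\<close>
  define j where "j = nat (round a)"
  have a: "0 \<le> a" "a \<le> real (N n)"
    unfolding a_def using real_of_unit[of x] by (auto intro: mult_left_le)
  have aj: "\<bar>a - real j\<bar> \<le> 1 / 2"
  proof -
    have "0 \<le> round a" using a by (simp add: round_def)
    then show ?thesis using of_int_round_abs_le[of a] unfolding j_def by (simp add: abs_minus_commute)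
  qed
  have "j \<le> N n" using aj a by linarith
  have "2 < real (N n) * dist x y" using assms by (simp add: field_simps)
  then have "2 < \<bar>a - b\<bar>"
    unfolding a_def b_def by (simp add: dist_unit_interval_def dist_real_def abs_mult right_diff_distrib[symmetric])
  \<comment> \<open>The separation of more than 2 spacings, less the rounding error 1/2, leaves
    \<open>y\<close> outside the support of the tent at \<open>j\<close>.\<close>
  then have "1 \<le> \<bar>b - real j\<bar>" using aj by linarith
  then have tb: "tent (b - real j) = 0" by (simp add: tent_def)
  define c where "c = (1 / 2) ^ n * tent (a - real j)"
  \<comment> \<open>The tent is at least 1/2 within half a spacing of its node; this turns
    \<open>2 * s / c\<close> into the bound \<open>4 * s * 2 ^ n\<close>.\<close>
  have c: "(1 / 2) ^ n * (1 / 2) \<le> c"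
    unfolding c_def using aj by (intro mult_left_mono) (auto simp: tent_def)
  then have "0 < c" by (rule less_le_trans[rotated]) simp
  have "emeasure cube_measure {u. w((n, j) := u) \<in> G} \<le> ennreal ((4 * s * 2 ^ n) ^ CARD('d))" for w
  proof -
    \<comment> \<open>The function with the resampled coefficient switched off: it does not involve
      \<open>u\<close>, so the increment is affine in \<open>truncate u\<close>.\<close>
    define h where "h = random_fun N (w((n, j) := 0)) + g"
    have "(random_fun N (w((n, j) := u)) + g) x $ i - (random_fun N (w((n, j) := u)) + g) y $ i
        = c * truncate u $ i + (h x - h y) $ i" for u i
      unfolding random_fun_upd[where N = N and n = n and j = j, OF \<open>j \<le> N n\<close>, of w u]
      using tb by (simp add: h_def apply_bump c_def a_def b_def algebra_simps)
    then have "{u. w((n, j) := u) \<in> G} = {u. \<forall>i. \<bar>c * truncate u $ i + (h x - h y) $ i\<bar> \<le> s}"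
      by (simp add: G_def)
    also have "emeasure cube_measure \<dots> \<le> ennreal ((2 * s / c) ^ CARD('d))"
      by (rule cube_measure_small_ball[OF \<open>0 < c\<close> \<open>0 \<le> s\<close>])
    also have "\<dots> \<le> ennreal ((4 * s * 2 ^ n) ^ CARD('d))"
    proof (intro ennreal_leI power_mono)
      have "2 * s / c \<le> 2 * s / ((1 / 2) ^ n * (1 / 2))"
        using c \<open>0 \<le> s\<close> by (intro divide_left_mono) (auto intro!: mult_pos_pos \<open>0 < c\<close>)
      also have "\<dots> = 4 * s * 2 ^ n" by (simp add: power_divide)
      finally show "2 * s / c \<le> 4 * s * 2 ^ n" .
      show "0 \<le> 2 * s / c" using \<open>0 < c\<close> \<open>0 \<le> s\<close> by simp
    qed
    finally show ?thesis .
  qed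
  then have "(\<integral>\<^sup>+w. emeasure cube_measure {u. w((n, j) := u) \<in> G} \<partial>noise)
      \<le> (\<integral>\<^sup>+w. ennreal ((4 * s * 2 ^ n) ^ CARD('d)) \<partial>(noise :: (nat \<times> nat \<Rightarrow> real^'d) measure))"
    by (intro nn_integral_mono)
  also have "\<dots> = ennreal ((4 * s * 2 ^ n) ^ CARD('d))"
    by (simp add: noise.emeasure_space_1[unfolded space_noise])
  also have "(\<integral>\<^sup>+w. emeasure cube_measure {u. w((n, j) := u) \<in> G} \<partial>noise) = emeasure noise G"
    by (rule noise_resample[symmetric]) (simp only: G_def near_values_sets)
  finally show ?thesis by (simp only: G_def)
qed

text \<open>By Fubini, the probability that a fixed pair is near is integrated over all pairs. Pairs
  within \<open>2 / N n\<close> get the trivial bound 1, pairs farther apart than \<open>s\<close>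
  are never near, and the rest lie in a strip of mass at most \<open>2 * s\<close>.\<close>

lemma expected_near_pairs_le:
  fixes g :: "unit_interval \<Rightarrow>\<^sub>C (real^'d)" and N :: "nat \<Rightarrow> nat"
  assumes "0 < N n" "0 \<le> s"
  shows "(\<integral>\<^sup>+w. emeasure (unit_lebesgue \<Otimes>\<^sub>M unit_lebesgue) (near_pairs s (random_fun N w + g)) \<partial>noise)
    \<le> ennreal (4 / real (N n) + 2 * s * (4 * s * 2 ^ n) ^ CARD('d))"
proof -
  let ?U = "unit_lebesgue \<Otimes>\<^sub>M unit_lebesgue"
  interpret pair_sigma_finite "noise :: (nat \<times> nat \<Rightarrow> real^'d) measure" ?U ..
  define X where "X = {(w, z). z \<in> near_pairs s (random_fun N w + g)}"
  have add_m [measurable]: "(\<lambda>f. f + g) \<in> borel_measurable borel"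
    by (intro borel_measurable_continuous_onI continuous_intros)
  have "(\<lambda>(w, z). (random_fun N w + g, z)) \<in> noise \<Otimes>\<^sub>M ?U \<rightarrow>\<^sub>M borel \<Otimes>\<^sub>M ?U"
    by measurable
  from measurable_sets[OF this near_pairs_measurable[of s]]
  have X: "X \<in> sets (noise \<Otimes>\<^sub>M ?U)"
    by (simp add: X_def vimage_def split_beta' space_pair_measure)
  define p where "p = ennreal ((4 * s * 2 ^ n) ^ CARD('d))"
  have bound: "emeasure noise ((\<lambda>w. (w, z)) -` X)
     \<le> indicator {(x, y). dist x y \<le> 2 / real (N n)} z + p * indicator {(x, y). dist x y \<le> s} z" for z
  proof -
    obtain x y where z: "z = (x, y)" by (cases z)
    consider "dist x y \<le> 2 / real (N n)" | "s < dist x y" | "2 / real (N n) < dist x y" "dist x y \<le> s" by linarith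
    then show ?thesis
    proof cases
      case 1
      then show ?thesis using noise.emeasure_le_1[of "(\<lambda>w. (w, z)) -` X"]
        by (simp add: z add_increasing2)
    next
      case 2
      then have "(\<lambda>w. (w, z)) -` X = {}" by (auto simp: X_def z near_pairs_def)
      then show ?thesis by simp
    next
      case 3
      then have "(\<lambda>w. (w, z)) -` X
        = {w. \<forall>i. \<bar>(random_fun N w + g) x $ i - (random_fun N w + g) y $ i\<bar> \<le> s}"
        by (auto simp: X_def z near_pairs_def)
      then show ?thesis
        using prob_near_values_le[of N n x y s g] assms 3 by (simp add: z p_def)
    qed
  qed
  have "(\<integral>\<^sup>+w. emeasure ?U (near_pairs s (random_fun N w + g)) \<partial>noise) = emeasure (noise \<Otimes>\<^sub>M ?U) X"
    unfolding sigma_finite_measure.emeasure_pair_measure_alt[OF unit_lebesgue_pair.sigma_finite_measure_axioms X] by (simp add: X_def vimage_def)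
  also have "\<dots> = (\<integral>\<^sup>+z. emeasure noise ((\<lambda>w. (w, z)) -` X) \<partial>?U)"
    by (rule emeasure_pair_measure_alt2[OF X])
  also have "\<dots> \<le> (\<integral>\<^sup>+z. indicator {(x, y). dist x y \<le> 2 / real (N n)} z + p * indicator {(x, y). dist x y \<le> s} z \<partial>?U)"
    by (intro nn_integral_mono bound)
  also have "\<dots> = emeasure ?U {(x, y). dist x y \<le> 2 / real (N n)} + p * emeasure ?U {(x, y). dist x y \<le> s}"
    using strip_sets by (simp add: nn_integral_add nn_integral_cmult)
  also have "\<dots> \<le> ennreal (2 * (2 / real (N n))) + p * ennreal (2 * s)"
    using assms by (intro add_mono mult_left_mono emeasure_unit_lebesgue_strip_le) auto
  also have "\<dots> = ennreal (4 / real (N n) + 2 * s * (4 * s * 2 ^ n) ^ CARD('d))"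
    using assms by (simp add: p_def mult.commute flip: ennreal_mult ennreal_plus)
  finally show ?thesis .
qed

section \<open>Prevalence\<close>

text \<open>The law of \<open>X\<close> is the witnessing measure: \<open>X w\<close> lies in the
  translate of \<open>B\<close> by \<open>x\<close> exactly if \<open>X w - x\<close> lies in
  \<open>B\<close>.\<close>

lemma shyI_AE:
  fixes A :: "'a::{topological_ab_group_add, polish_space} set"
  assumes "prob_space M" "X \<in> borel_measurable M"
    and B: "B \<in> sets borel" "A \<subseteq> B"
    and AE: "\<And>x. AE w in M. X w - x \<notin> B"
  shows "shy A"
  unfolding shy_def
proof (intro bexI[of _ B] exI[of _ "distr M borel X"] conjI allI)
  show "prob_space (distr M borel X)" using assms by (intro prob_space.prob_space_distr)
  fix x
  have "emeasure (distr M borel X) ((\<lambda>b. b + x) ` B)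
      = emeasure M (X -` ((\<lambda>b. b + x) ` B) \<inter> space M)"
    by (intro emeasure_distr assms borel_translate)
  also have "\<dots> = 0"
  proof -
    have "X w - x \<in> B" if "X w \<in> (\<lambda>b. b + x) ` B" for w using that by auto
    then have "AE w in M. w \<notin> X -` ((\<lambda>b. b + x) ` B)" using AE[of x] by (auto elim: AE_mp)
    moreover have "X -` ((\<lambda>b. b + x) ` B) \<inter> space M \<in> sets M"
      using assms by (intro measurable_sets[of X M borel] borel_translate)
    ultimately show ?thesis
      by (subst (asm) AE_iff_measurable[of "X -` ((\<lambda>b. b + x) ` B) \<inter> space M"]) auto
  qed
  finally show "emeasure (distr M borel X) ((\<lambda>b. b + x) ` B) = 0" .
qed (use B in auto)

lemma gauge_scales:
  assumes "filterlim (\<lambda>r. \<psi> r / r ^ D) at_top (at_right (0 :: real))"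
  obtains s :: "nat \<Rightarrow> real" where "\<And>n. 0 < s n" "s \<longlonglongrightarrow> 0"
    "\<And>n r. 0 < r \<Longrightarrow> r \<le> s n \<Longrightarrow> M n * r ^ D \<le> \<psi> r"
proof -
  have "\<exists>b>0. \<forall>r. 0 < r \<and> r < b \<longrightarrow> M n \<le> \<psi> r / r ^ D" for n
    using assms unfolding filterlim_at_top eventually_at_right_field by metis
  then obtain b where b: "\<And>n. 0 < b n" "\<And>n r. 0 < r \<Longrightarrow> r < b n \<Longrightarrow> M n \<le> \<psi> r / r ^ D"
    by metis
  \<comment> \<open>Halving keeps \<open>s n\<close> strictly inside the range of the growth bound;
    the second term forces convergence to 0.\<close>
  define s where "s n = min (b n / 2) (1 / real (Suc n))" for n
  show thesis
  proof (rule that[of s])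
    show pos: "0 < s n" for n using b(1)[of n] by (simp add: s_def)
    show "s \<longlonglongrightarrow> 0"
      by (rule tendsto_sandwich[OF _ _ tendsto_const LIMSEQ_Suc[OF lim_1_over_n]])
        (use pos in \<open>auto simp: s_def intro!: always_eventually less_imp_le\<close>)
    show "M n * r ^ D \<le> \<psi> r" if "0 < r" "r \<le> s n" for n r
    proof -
      have "r < b n" using that b(1)[of n] by (auto simp: s_def)
      then show ?thesis using b(2)[of r n] that by (simp add: le_divide_eq)
    qed
  qed
qed

theorem theorem8p4:
  fixes \<psi> :: "real \<Rightarrow> real"
  assumes "gauge_function \<psi>"
    and "filterlim (\<lambda>r. \<psi> r / r ^ (CARD('d::finite) + 1)) at_top (at_right 0)"
  shows "prevalent {f :: unit_interval \<Rightarrow>\<^sub>C (real ^ 'd). hausdorff_measure \<psi> (graph_of f) > 0}"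
proof -
  define D where "D = CARD('d) + 1"
  \<comment> \<open>The constant in the expected bound \<open>c n * s (Suc n) ^ D\<close>. It is
    fixed before the scales; the summand 4 is reserved for the term \<open>4 / N n\<close>.\<close>
  define c :: "nat \<Rightarrow> real" where "c n = 4 + 2 * (4 * 2 ^ n) ^ CARD('d)" for n
  have c_pos: "0 < c n" for n unfolding c_def by (intro add_pos_nonneg) auto
  obtain s where s_pos: "\<And>n. 0 < s n" and s_lim: "s \<longlonglongrightarrow> 0"
    and growth: "\<And>n r. 0 < r \<Longrightarrow> r \<le> s n \<Longrightarrow> 8 ^ n * c n * r ^ (CARD('d) + 1) \<le> \<psi> r"
    using gauge_scales[OF assms(2), of "\<lambda>n. 8 ^ n * c n"] by metis
  \<comment> \<open>The node numbers are chosen after the scales, so that \<open>4 / N n\<close> is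
    at most \<open>4 * s (Suc n) ^ D\<close>.\<close>
  have "\<exists>N :: nat. 0 < N \<and> 1 / real N \<le> s (Suc n) ^ D" for n
    using real_arch_inverse[of "s (Suc n) ^ D"] s_pos[of "Suc n"] by (auto simp: inverse_eq_divide intro: less_imp_le)
  then obtain N :: "nat \<Rightarrow> nat" where N: "\<And>n. 0 < N n" "\<And>n. 1 / real (N n) \<le> s (Suc n) ^ D"
    by metis
  let ?U = "unit_lebesgue \<Otimes>\<^sub>M unit_lebesgue"
  \<comment> \<open>Normalised so that the level \<open>n\<close> term of \<open>W\<close> below has
    expectation at most \<open>(1 / 2) ^ n\<close>. Finiteness of \<open>W f\<close> then gives the
    near-pair bounds of all levels with one constant \<open>L\<close> depending on
    \<open>f\<close>.\<close>
  define w :: "nat \<Rightarrow> real" where "w n = 1 / (2 ^ n * c n * s (Suc n) ^ D)" for n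
  have w_pos: "0 < w n" for n unfolding w_def using c_pos s_pos by simp
  define W :: "(unit_interval \<Rightarrow>\<^sub>C (real^'d)) \<Rightarrow> ennreal"
    where "W f = (\<Sum>n. ennreal (w n) * emeasure ?U (near_pairs (s (Suc n)) f))" for f
  have near_m [measurable]: "(\<lambda>f :: unit_interval \<Rightarrow>\<^sub>C (real^'d). emeasure ?U (near_pairs r f))
      \<in> borel_measurable borel" for r
    using sigma_finite_measure.measurable_emeasure_Pair[OF unit_lebesgue_pair.sigma_finite_measure_axioms
        near_pairs_measurable[of r]]
    by (simp add: vimage_def)
  have W_m [measurable]: "W \<in> borel_measurable borel"
    unfolding W_def[abs_def] by measurable
  have pos: "0 < hausdorff_measure \<psi> (graph_of f)" if "W f \<noteq> \<infinity>" for f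
  proof -
    define L where "L = enn2real (W f) + 1"
    have W_eq: "W f = ennreal (enn2real (W f))" using that by (simp add: less_top)
    have L: "0 < L" unfolding L_def by (simp add: add_nonneg_pos)
    have near: "measure ?U (near_pairs (s (Suc n)) f) \<le> L * 2 ^ n * c n * s (Suc n) ^ (CARD('d) + 1)" for n
    proof -
      have "ennreal (w n * measure ?U (near_pairs (s (Suc n)) f))
          = ennreal (w n) * emeasure ?U (near_pairs (s (Suc n)) f)"
        using w_pos[of n] by (simp add: unit_lebesgue_pair.emeasure_eq_measure ennreal_mult)
      also have "\<dots> \<le> W f"
        unfolding W_def using sum_le_suminf[of "\<lambda>n. ennreal (w n) * emeasure ?U (near_pairs (s (Suc n)) f)" "{n}"]
        by simp
      also have "\<dots> \<le> ennreal L" by (subst W_eq, rule ennreal_leI) (simp add: L_def)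
      finally have "w n * measure ?U (near_pairs (s (Suc n)) f) \<le> L" using L by (simp add: ennreal_le_iff)
      moreover have "0 < 2 ^ n * c n * s (Suc n) ^ D" using c_pos s_pos by simp
      ultimately show ?thesis unfolding w_def D_def[symmetric] by (simp add: divide_le_eq mult_ac)
    qed
    have "0 < ennreal (1 / (4 * 4 ^ (CARD('d) + 1) * L))" using L by simp
    also have "\<dots> \<le> hausdorff_pre \<psi> (s 0) (graph_of f)"
      by (rule hausdorff_pre_graph_ge[OF assms(1) s_pos s_lim c_pos growth near L])
    also have "\<dots> \<le> hausdorff_measure \<psi> (graph_of f)"
      unfolding hausdorff_measure_eq_SUP using s_pos by (intro SUP_upper) auto
    finally show ?thesis .
  qed
  \<comment> \<open>A first-moment argument: for every translate the expectation of \<open>W\<close>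
    is at most a geometric series, so \<open>W\<close> is almost surely finite.\<close>
  have "AE v in noise. W (random_fun N v - g) \<noteq> \<infinity>" for g
  proof (rule nn_integral_PInf_AE)
    have [measurable]: "(\<lambda>f. f - g) \<in> borel_measurable borel"
      by (intro borel_measurable_continuous_onI continuous_intros)
    show "(\<lambda>v. W (random_fun N v - g)) \<in> borel_measurable noise" by measurable
    have [measurable]: "(\<lambda>v. emeasure ?U (near_pairs r (random_fun N v - g))) \<in> borel_measurable noise" for r
      by measurable
    have "(\<integral>\<^sup>+v. W (random_fun N v - g) \<partial>noise)
      = (\<Sum>n. ennreal (w n) * (\<integral>\<^sup>+v. emeasure ?U (near_pairs (s (Suc n)) (random_fun N v - g)) \<partial>noise))"
      unfolding W_def by (subst nn_integral_suminf) (auto simp: nn_integral_cmult)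
    also have "\<dots> \<le> (\<Sum>n. ennreal ((1 / 2) ^ n))"
    proof (intro suminf_le allI)
      fix n
      let ?s = "s (Suc n)"
      have "(\<integral>\<^sup>+v. emeasure ?U (near_pairs ?s (random_fun N v - g)) \<partial>noise)
        \<le> ennreal (4 / real (N n) + 2 * ?s * (4 * ?s * 2 ^ n) ^ CARD('d))"
        using expected_near_pairs_le[of N n ?s "- g"] N(1) s_pos[of "Suc n"] by simp
      also have "\<dots> \<le> ennreal (c n * ?s ^ D)"
      proof (rule ennreal_leI)
        have "2 * ?s * (4 * ?s * 2 ^ n) ^ CARD('d) = 2 * (4 * 2 ^ n) ^ CARD('d) * ?s ^ D"
          by (simp add: D_def power_mult_distrib mult_ac)
        then show "4 / real (N n) + 2 * ?s * (4 * ?s * 2 ^ n) ^ CARD('d) \<le> c n * ?s ^ D"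
          using N(2)[of n] by (simp add: c_def distrib_right)
      qed
      finally have "ennreal (w n) * (\<integral>\<^sup>+v. emeasure ?U (near_pairs ?s (random_fun N v - g)) \<partial>noise)
        \<le> ennreal (w n) * ennreal (c n * ?s ^ D)" by (rule mult_left_mono) simp
      also have "\<dots> = ennreal ((1 / 2) ^ n)"
        using w_pos[of n] c_pos[of n] s_pos[of "Suc n"]
        by (simp add: ennreal_mult[symmetric] w_def power_divide)
      finally show "ennreal (w n) * (\<integral>\<^sup>+v. emeasure ?U (near_pairs ?s (random_fun N v - g)) \<partial>noise)
        \<le> ennreal ((1 / 2) ^ n)" .
    qed auto
    also have "\<dots> = ennreal (\<Sum>n. (1 / 2) ^ n)"
      by (intro suminf_ennreal2) (auto intro!: summable_geometric)
    also have "\<dots> < \<infinity>" by simp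
    finally show "(\<integral>\<^sup>+v. W (random_fun N v - g) \<partial>noise) \<noteq> \<infinity>" by simp
  qed
  \<comment> \<open>This Borel set contains all exceptional functions and serves as the superset
    demanded by \<open>shy\<close>.\<close>
  then have "shy {f. W f = \<infinity>}"
    using prob_space_noise by (intro shyI_AE[where M = noise and X = "random_fun N" and B = "{f. W f = \<infinity>}"]) auto
  moreover have "- {f. 0 < hausdorff_measure \<psi> (graph_of f)} \<subseteq> {f. W f = \<infinity>}"
    using pos by auto
  ultimately show ?thesis
    unfolding prevalent_def shy_def by (meson order_trans)
qed

end
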